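(* Let $(X,d,\mu)$ be a metric space with a doubling Borel regular measure $\mu$, let $B_0\subset X$ be a ball, let $1<p<\infty$ and let $f\in L^p(11B_0)$. Then $f\in JN_p(B_0)$.
   Context: A ball is an open ball $B=B(x,r)=\{y\in X: d(y,x)<r\}$, $r>0$, always understood to come with a specified center $x$ and radius $r$; for $\lambda>0$, $\lambda B$ denotes the ball with the same center and radius $\lambda r$. The measure $\mu$ is doubling: every ball has positive and finite measure, and there is a constant $c_\mu\geq 1$ (the doubling constant) such that $\mu(2B)\leq c_\mu\,\mu(B)$ for all balls $B$ in $X$. Write $f_B=\frac{1}{\mu(B)}\int_B f\,d\mu$. Definition of $JN_p(B_0)$: let $1<p<\infty$ and let $B_0\subset X$ be a ball. Let $f$ be a real-valued locally integrable function defined on $11B_0$, meaning integrable over every ball contained in $11B_0$ (including $11B_0$ itself). Then $f\in JN_p(B_0)$ if there exists $K_f<\infty$ such that $$\sum_i \mu(B_i)\left(\frac{1}{\mu(B_i)}\int_{B_i}|f-f_{B_i}|\,d\mu\right)^p\leq K_f^p$$ whenever $\{B_i\}$ is a countable (possibly finite) collection of balls with centers in $B_0$ and contained in $11B_0$ such that the balls $\frac15 B_i$ are pairwise disjoint. *)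

theory Defs
  imports "HOL-Analysis.Analysis"
begin

text \<open>
  Balls carry a specified centre and radius, so a ball is given by its data \<open>x\<close>, \<open>r\<close> with
  \<open>r > 0\<close>; its point set is \<^term>\<open>ball x r\<close> and its dilate by \<open>\<lambda>\<close> is \<open>ball x (\<lambda> * r)\<close>.
\<close>

text \<open>
  The sigma-algebra of \<open>M\<close> may be any one containing the Borel sets. This covers the Borel
  sigma-algebra itself, its completion, and the Caratheodory-measurable sets of a Borel regular
  outer measure. The first condition forces \<open>space M = UNIV\<close>.
\<close>

definition borel_regular :: "'a::metric_space measure \<Rightarrow> bool" where
  "borel_regular M \<longleftrightarrow>
     sets borel \<subseteq> sets M \<and>
     (\<forall>A\<in>sets M. \<exists>B\<in>sets borel. A \<subseteq> B \<and> emeasure M B = emeasure M A)"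

definition doubling :: "'a::metric_space measure \<Rightarrow> bool" where
  "doubling M \<longleftrightarrow>
     (\<forall>x r. r > 0 \<longrightarrow> 0 < emeasure M (ball x r) \<and> emeasure M (ball x r) < \<infinity>) \<and>
     (\<exists>c\<ge>1::real. \<forall>x r. r > 0 \<longrightarrow>
        emeasure M (ball x (2 * r)) \<le> ennreal c * emeasure M (ball x r))"

text \<open>
  Functions on a subset \<open>A\<close> are represented by total functions whose values outside \<open>A\<close> are
  irrelevant.
\<close>

definition Lp_on :: "'a measure \<Rightarrow> real \<Rightarrow> 'a set \<Rightarrow> ('a \<Rightarrow> real) set" where
  "Lp_on M p A =
     {f. set_borel_measurable M A f \<and> set_integrable M A (\<lambda>y. \<bar>f y\<bar> powr p)}"

definition average :: "'a measure \<Rightarrow> 'a set \<Rightarrow> ('a \<Rightarrow> real) \<Rightarrow> real" where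
  "average M A f = (1 / measure M A) * set_lebesgue_integral M A f"

text \<open>
  A collection of balls is a set of (centre, radius) pairs. No generality is lost against indexed
  families, since disjointness of the (nonempty) balls \<open>ball x (r / 5)\<close> rules out repetitions.
  The sum is taken in \<^typ>\<open>ennreal\<close>, so that it is always defined and the bound includes its
  convergence.
\<close>

definition JN :: "'a::metric_space measure \<Rightarrow> real \<Rightarrow> 'a \<Rightarrow> real \<Rightarrow> ('a \<Rightarrow> real) set" where
  "JN M p x0 r0 =
     {f. (\<forall>x r. r > 0 \<and> ball x r \<subseteq> ball x0 (11 * r0) \<longrightarrow> set_integrable M (ball x r) f) \<and>
         (\<exists>K\<ge>0. \<forall>\<B> :: ('a \<times> real) set.
            countable \<B> \<and>
            (\<forall>(x, r)\<in>\<B>. r > 0 \<and> x \<in> ball x0 r0 \<and> ball x r \<subseteq> ball x0 (11 * r0)) \<and>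
            disjoint_family_on (\<lambda>(x, r). ball x (r / 5)) \<B> \<longrightarrow>
            (\<Sum>\<^sub>\<infinity>(x, r)\<in>\<B>. ennreal (measure M (ball x r) *
                (average M (ball x r) (\<lambda>y. \<bar>f y - average M (ball x r) f\<bar>)) powr p))
              \<le> ennreal (K powr p))}"

end

theory Submission
  imports Defs
begin

text \<open>
  The mean oscillation of \<open>f\<close> over a ball \<open>B\<^sub>i\<close> is at most twice the average \<open>a\<^sub>i\<close> of \<open>\<bar>f\<bar>\<close>
  over \<open>B\<^sub>i\<close> (\<open>oscillation_le\<close>). By doubling, \<open>B\<^sub>i\<close> and \<open>B\<^sub>i / 5\<close> have comparable measure, so it
  suffices to bound \<open>\<Sum>\<^sub>i \<mu>(E\<^sub>i) a\<^sub>i\<^sup>p\<close> by a multiple of \<open>\<integral>\<bar>f\<bar>\<^sup>p\<close>, where the sets \<open>E\<^sub>i = B\<^sub>i / 5\<close> are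
  disjoint while the balls \<open>B\<^sub>i\<close> may overlap. On \<open>E\<^sub>i\<close> the number \<open>a\<^sub>i\<close> is dominated by the
  Hardy-Littlewood maximal function of \<open>f\<close>, so the bound is the \<open>L\<^sup>p\<close> maximal inequality. Because
  only finitely many balls have to be treated at a time, it can be proved for the numbers \<open>a\<^sub>i\<close>
  themselves, without introducing the maximal function or discussing its measurability.

  The argument is the classical one. A finite Vitali covering (\<open>finite_Vitali_covering\<close>) gives the
  weak-type estimate \<open>t \<Sum>{\<mu>(E\<^sub>i) : a\<^sub>i \<ge> t} \<le> c\<^sup>2 \<integral>\<bar>f\<bar>\<close> (\<open>weak_type\<close>). The part of \<open>f\<close> where
  \<open>\<bar>f\<bar> \<le> t/2\<close> contributes at most \<open>t/2\<close> to each average, so the same estimate holds, up to a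
  factor 2, with the integral on the right taken only over \<open>{\<bar>f\<bar> > t/2}\<close> (\<open>truncated_average\<close>).
  Integrating this over all levels \<open>t\<close> and exchanging the integrals gives the strong-type bound
  (\<open>strong_type\<close>), and \<open>p > 1\<close> is what makes the integral over the levels converge. The bound is
  uniform over finite subfamilies and hence passes to countable ones.
\<close>

section \<open>A finite Vitali covering\<close>

text \<open>
  Greedy selection: keep a ball of maximal radius, discard the balls that meet it, and recurse.
  A discarded ball is no larger than the selected one that it meets, so it lies in the threefold
  dilate.
\<close>
lemma finite_Vitali_covering:
  fixes x :: "'i \<Rightarrow> 'a::metric_space" and r :: "'i \<Rightarrow> real"
  assumes "finite I"
  shows "\<exists>J\<subseteq>I. disjoint_family_on (\<lambda>j. ball (x j) (r j)) J \<and>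
           (\<forall>i\<in>I. \<exists>j\<in>J. ball (x i) (r i) \<subseteq> ball (x j) (3 * r j))"
  using assms
proof (induction "card I" arbitrary: I rule: less_induct)
  case less
  show ?case
  proof (cases "\<forall>i\<in>I. ball (x i) (r i) = {}")
    case True
    then show ?thesis
      unfolding disjoint_family_on_def by (intro exI[of _ I] conjI) (fast, fast, blast)
  next
    case False
    then have ne: "I \<noteq> {}" by auto
    define R where "R = Max (r ` I)"
    obtain k where k: "k \<in> I" "r k = R"
      using Max_in[of "r ` I"] ne less.prems unfolding R_def by fastforce
    have max: "r i \<le> r k" if "i \<in> I" for i
      using that k less.prems by (simp add: R_def)
    define I' where "I' = {i \<in> I. ball (x i) (r i) \<inter> ball (x k) (r k) = {}}"
    \<comment> \<open>If the largest radius were not positive, every ball would be empty.\<close>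
    have "r k > 0"
      using False max by (force simp: not_le)
    then have "k \<notin> I'" by (auto simp: I'_def)
    moreover have "I' \<subseteq> I" by (auto simp: I'_def)
    ultimately have "I' \<subset> I" using k by blast
    then have "card I' < card I" "finite I'"
      using less.prems by (auto intro: psubset_card_mono finite_subset)
    from less.hyps[OF this] obtain J where J: "J \<subseteq> I'"
      "disjoint_family_on (\<lambda>j. ball (x j) (r j)) J"
      "\<And>i. i \<in> I' \<Longrightarrow> \<exists>j\<in>J. ball (x i) (r i) \<subseteq> ball (x j) (3 * r j)"
      by meson
    have near: "ball (x i) (r i) \<subseteq> ball (x k) (3 * r k)" if i: "i \<in> I" "i \<notin> I'" for i
    proof
      fix z assume z: "z \<in> ball (x i) (r i)"
      obtain w where w: "dist (x i) w < r i" "dist (x k) w < r k"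
        using i by (auto simp: I'_def)
      have "dist (x k) z \<le> dist (x k) w + dist (x i) w + dist (x i) z"
        by (smt (verit) dist_commute dist_triangle)
      then show "z \<in> ball (x k) (3 * r k)"
        using w z max[OF i(1)] by simp
    qed
    have "disjoint_family_on (\<lambda>j. ball (x j) (r j)) (insert k J)"
      using J(1,2) \<open>k \<notin> I'\<close>
      by (subst disjoint_family_on_insert) (auto simp: I'_def)
    moreover have "\<exists>j\<in>insert k J. ball (x i) (r i) \<subseteq> ball (x j) (3 * r j)" if "i \<in> I" for i
      using J(3) near that by blast
    moreover have "insert k J \<subseteq> I" using J(1) k by (auto simp: I'_def)
    ultimately show ?thesis by blast
  qed
qed

section \<open>Balls under a doubling measure\<close>

locale doubling_measure =
  fixes M :: "'a::metric_space measure" and c :: real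
  assumes borel_sets: "sets borel \<subseteq> sets M"
    and ball_pos: "r > 0 \<Longrightarrow> 0 < emeasure M (ball x r)"
    and ball_finite: "r > 0 \<Longrightarrow> emeasure M (ball x r) < \<infinity>"
    and ball_double: "r > 0 \<Longrightarrow> emeasure M (ball x (2 * r)) \<le> ennreal c * emeasure M (ball x r)"
begin

lemma space_eq: "space M = UNIV"
proof -
  have "UNIV \<in> sets M"
    using borel_sets by (metis borel_open open_UNIV subsetD)
  then show ?thesis
    using sets.sets_into_space by blast
qed

lemma ball_sets [measurable]: "ball x r \<in> sets M"
  using borel_sets by (metis borel_open open_ball subsetD)

lemma sigma_finite: "sigma_finite_measure M"
proof
  fix z :: 'a
  have "\<Union> (range (\<lambda>n. ball z (real (Suc n)))) = UNIV"
  proof -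
    have "\<exists>n. dist z y < real (Suc n)" for y
      by (metis reals_Archimedean2 less_trans of_nat_less_iff lessI)
    then show ?thesis by auto
  qed
  then show "\<exists>A. countable A \<and> A \<subseteq> sets M \<and> \<Union> A = space M \<and> (\<forall>a\<in>A. emeasure M a \<noteq> \<infinity>)"
    using ball_finite[of "real (Suc _)" z]
    by (intro exI[of _ "range (\<lambda>n. ball z (real (Suc n)))"]) (auto simp: space_eq less_top)
qed

lemma emeasure_ball_eq: "r > 0 \<Longrightarrow> emeasure M (ball x r) = ennreal (measure M (ball x r))"
  using ball_finite[of r x] by (simp add: emeasure_eq_ennreal_measure less_top)

lemma measure_ball_pos: "r > 0 \<Longrightarrow> 0 < measure M (ball x r)"
  using ball_pos[of r x] by (simp add: emeasure_ball_eq)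

lemma ball_double_power:
  assumes "r > 0" "s \<le> 2 ^ n * r"
  shows "emeasure M (ball x s) \<le> ennreal c ^ n * emeasure M (ball x r)"
proof -
  have "emeasure M (ball x (2 ^ n * r)) \<le> ennreal c ^ n * emeasure M (ball x r)"
  proof (induction n)
    case (Suc n)
    have "emeasure M (ball x (2 ^ Suc n * r)) \<le> ennreal c * emeasure M (ball x (2 ^ n * r))"
      using ball_double[of "2 ^ n * r" x] assms(1) by (simp add: mult.assoc)
    also have "\<dots> \<le> ennreal c * (ennreal c ^ n * emeasure M (ball x r))"
      by (intro mult_left_mono Suc.IH) simp
    finally show ?case by (simp add: mult.assoc)
  qed simp
  moreover have "emeasure M (ball x s) \<le> emeasure M (ball x (2 ^ n * r))"
    by (intro emeasure_mono subset_ball assms ball_sets)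
  ultimately show ?thesis by (rule order_trans[rotated])
qed

section \<open>The maximal inequality for finite families of balls\<close>

text \<open>
  The union of the \<open>E\<^sub>i\<close> is covered by the threefold dilates of a disjoint subfamily of the balls;
  those dilates lie in the fourfold ones, hence two doublings and the factor \<open>c\<^sup>2\<close>. On the disjoint
  subfamily the integrals of \<open>F\<close> add up to at most the full integral.
\<close>
lemma weak_type:
  fixes x :: "'i \<Rightarrow> 'a" and F :: "'a \<Rightarrow> ennreal" and t :: ennreal
  assumes I: "finite I" "\<And>i. i \<in> I \<Longrightarrow> r i > 0"
    and E: "disjoint_family_on E I" "\<And>i. i \<in> I \<Longrightarrow> E i \<in> sets M"
      "\<And>i. i \<in> I \<Longrightarrow> E i \<subseteq> ball (x i) (r i)"
    and F [measurable]: "F \<in> borel_measurable M"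
    and avg: "\<And>i. i \<in> I \<Longrightarrow> t * emeasure M (ball (x i) (r i)) \<le> (\<integral>\<^sup>+y\<in>ball (x i) (r i). F y \<partial>M)"
  shows "t * (\<Sum>i\<in>I. emeasure M (E i)) \<le> ennreal c ^ 2 * (\<integral>\<^sup>+y. F y \<partial>M)"
proof -
  obtain J where J: "J \<subseteq> I" "disjoint_family_on (\<lambda>j. ball (x j) (r j)) J"
    "\<And>i. i \<in> I \<Longrightarrow> \<exists>j\<in>J. ball (x i) (r i) \<subseteq> ball (x j) (3 * r j)"
    using finite_Vitali_covering[OF I(1), of x r] by blast
  have finJ: "finite J" using J(1) I(1) finite_subset by blast
  have "(\<Sum>i\<in>I. emeasure M (E i)) = emeasure M (\<Union>i\<in>I. E i)"
    using E I by (intro sum_emeasure) auto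
  also have "\<dots> \<le> emeasure M (\<Union>j\<in>J. ball (x j) (3 * r j))"
  proof (rule emeasure_mono)
    show "(\<Union>i\<in>I. E i) \<subseteq> (\<Union>j\<in>J. ball (x j) (3 * r j))"
    proof (rule UN_least)
      fix i assume "i \<in> I"
      then show "E i \<subseteq> (\<Union>j\<in>J. ball (x j) (3 * r j))"
        using E(3)[of i] J(3)[of i] by fast
    qed
    show "(\<Union>j\<in>J. ball (x j) (3 * r j)) \<in> sets M"
      by (intro sets.finite_UN finJ ball_sets)
  qed
  also have "\<dots> \<le> (\<Sum>j\<in>J. emeasure M (ball (x j) (3 * r j)))"
    by (intro emeasure_subadditive_finite finJ) auto
  also have "\<dots> \<le> (\<Sum>j\<in>J. ennreal c ^ 2 * emeasure M (ball (x j) (r j)))"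
  proof (rule sum_mono)
    fix j assume "j \<in> J"
    then have "r j > 0" using I J by auto
    then show "emeasure M (ball (x j) (3 * r j)) \<le> ennreal c ^ 2 * emeasure M (ball (x j) (r j))"
      by (intro ball_double_power) auto
  qed
  finally have "t * (\<Sum>i\<in>I. emeasure M (E i))
      \<le> t * (\<Sum>j\<in>J. ennreal c ^ 2 * emeasure M (ball (x j) (r j)))"
    by (intro mult_left_mono) auto
  also have "\<dots> = ennreal c ^ 2 * (\<Sum>j\<in>J. t * emeasure M (ball (x j) (r j)))"
    by (simp add: sum_distrib_left mult_ac)
  also have "\<dots> \<le> ennreal c ^ 2 * (\<Sum>j\<in>J. \<integral>\<^sup>+y\<in>ball (x j) (r j). F y \<partial>M)"
    using J(1) avg by (intro mult_left_mono sum_mono) auto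
  also have "(\<Sum>j\<in>J. \<integral>\<^sup>+y\<in>ball (x j) (r j). F y \<partial>M)
      = (\<integral>\<^sup>+y. (\<Sum>j\<in>J. F y * indicator (ball (x j) (r j)) y) \<partial>M)"
    by (rule nn_integral_sum[symmetric]) measurable
  also have "\<dots> = (\<integral>\<^sup>+y. F y * indicator (\<Union>j\<in>J. ball (x j) (r j)) y \<partial>M)"
    by (simp add: sum_distrib_left[symmetric] indicator_UN_disjoint[OF finJ J(2)])
  also have "\<dots> \<le> (\<integral>\<^sup>+y. F y \<partial>M)"
    by (intro nn_integral_mono) (auto simp: indicator_def)
  finally show ?thesis by (simp add: mult_left_mono)
qed

text \<open>
  Where \<open>2 F \<le> t\<close>, the function contributes at most \<open>t/2\<close> to its average. If the average exceeds
  \<open>t\<close>, at least \<open>t/2\<close> of it must therefore come from the set \<open>{2 F > t}\<close>.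
\<close>
lemma truncated_average:
  fixes F :: "'a \<Rightarrow> real"
  assumes r: "r > 0" and t: "0 < t" "t < a"
    and F [measurable]: "F \<in> borel_measurable M"
    and avg: "ennreal a * emeasure M (ball x r) \<le> (\<integral>\<^sup>+y\<in>ball x r. ennreal (F y) \<partial>M)"
  shows "ennreal (t / 2) * emeasure M (ball x r)
           \<le> (\<integral>\<^sup>+y\<in>ball x r. ennreal (F y) * indicator {y. t < 2 * F y} y \<partial>M)" (is "?L \<le> ?R")
proof -
  have [measurable]: "{y. t < 2 * F y} \<in> sets M"
    using borel_measurable_less[of "\<lambda>_. t" M "\<lambda>y. 2 * F y"] by (simp add: space_eq)
  have "?L + ?L = ennreal t * emeasure M (ball x r)"
    using t by (simp flip: distrib_right ennreal_plus)
  also have "\<dots> \<le> ennreal a * emeasure M (ball x r)"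
    using t by (intro mult_right_mono ennreal_leI) auto
  also have "\<dots> \<le> (\<integral>\<^sup>+y\<in>ball x r. ennreal (F y) \<partial>M)"
    by (rule avg)
  also have "\<dots> \<le> (\<integral>\<^sup>+y. ennreal (F y) * indicator {y. t < 2 * F y} y * indicator (ball x r) y
                   + ennreal (t / 2) * indicator (ball x r) y \<partial>M)"
    by (intro nn_integral_mono) (auto simp: indicator_def intro!: ennreal_leI)
  also have "\<dots> = ?R + ?L"
    by (subst nn_integral_add) (simp_all add: nn_integral_cmult_indicator)
  finally have "?L + ?L \<le> ?L + ?R"
    by (simp add: add.commute)
  moreover have "?L \<noteq> top"
    using ball_finite[OF r, of x] by (simp add: ennreal_mult_eq_top_iff less_top)
  ultimately show ?thesis
    by (simp add: ennreal_add_left_cancel_le)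
qed

end

text \<open>
  With \<open>p = q + 1\<close> and the levels parametrised by \<open>u = t\<^sup>q\<close>, this is the layer-cake formula for
  \<open>a\<^sup>p\<close>, up to a constant. In this parametrisation the weight on the levels is \<open>u powr (1/q) = t\<close>,
  which cancels exactly against the factor \<open>t\<close> of the weak-type estimate; what remains on the other
  side is the Lebesgue measure of an interval. Only one inequality is needed here, and the upper
  half of the interval already gives it.
\<close>
lemma powr_le_layers:
  fixes a q :: real
  assumes "0 \<le> a" "0 < q"
  shows "ennreal (a powr (q + 1))
    \<le> ennreal (2 * 2 powr (1 / q)) *
       (\<integral>\<^sup>+u. ennreal (u powr (1 / q)) * indicator {0<..<a powr q} u \<partial>lborel)"
proof (cases "a = 0")
  case False
  define b where "b = a powr q"
  have a: "a > 0" and b: "b > 0" using assms False by (auto simp: b_def)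
  have ba: "b powr (1 / q) = a" using a assms by (simp add: b_def powr_powr)
  have "a powr (q + 1) = 2 * 2 powr (1 / q) * ((b / 2) powr (1 / q) * (b / 2))"
    using a b assms ba by (simp add: powr_divide powr_add b_def)
  moreover have "emeasure lborel {b/2<..<b} = ennreal (b / 2)"
    using b by simp
  ultimately have "ennreal (a powr (q + 1))
      = ennreal (2 * 2 powr (1 / q)) * (ennreal ((b / 2) powr (1 / q)) * emeasure lborel {b/2<..<b})"
    using b by (simp only: ennreal_mult[symmetric] powr_ge_zero mult_nonneg_nonneg zero_le_numeral
        half_gt_zero less_imp_le)
  also have "\<dots> = ennreal (2 * 2 powr (1 / q)) *
      (\<integral>\<^sup>+u. ennreal ((b / 2) powr (1 / q)) * indicator {b/2<..<b} u \<partial>lborel)"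
    by (simp add: nn_integral_cmult_indicator)
  also have "\<dots> \<le> ennreal (2 * 2 powr (1 / q)) *
       (\<integral>\<^sup>+u. ennreal (u powr (1 / q)) * indicator {0<..<b} u \<partial>lborel)"
    using b assms
    by (intro mult_left_mono nn_integral_mono)
       (auto simp: indicator_def intro!: ennreal_leI powr_mono2)
  finally show ?thesis by (simp add: b_def)
qed simp

context doubling_measure
begin

text \<open>
  The \<open>L\<^sup>p\<close> maximal inequality for \<open>p = q + 1\<close>, in discrete form. For each level \<open>u = t\<^sup>q\<close> the
  weak-type estimate is applied to the truncation of \<open>F\<close> to \<open>{2 F > t}\<close>; integrating over \<open>u\<close> and
  exchanging integrals turns the right-hand side into \<open>\<integral> F (2 F)\<^sup>q\<close>.
\<close>
lemma strong_type:
  fixes x :: "'i \<Rightarrow> 'a" and F :: "'a \<Rightarrow> real" and a :: "'i \<Rightarrow> real" and q :: real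
  assumes I: "finite I" "\<And>i. i \<in> I \<Longrightarrow> r i > 0"
    and E: "disjoint_family_on E I" "\<And>i. i \<in> I \<Longrightarrow> E i \<in> sets M"
      "\<And>i. i \<in> I \<Longrightarrow> E i \<subseteq> ball (x i) (r i)"
    and q: "q > 0"
    and F [measurable]: "F \<in> borel_measurable M" and F0: "\<And>y. 0 \<le> F y"
    and a0: "\<And>i. i \<in> I \<Longrightarrow> 0 \<le> a i"
    and avg: "\<And>i. i \<in> I \<Longrightarrow> ennreal (a i) * emeasure M (ball (x i) (r i))
                \<le> (\<integral>\<^sup>+y\<in>ball (x i) (r i). ennreal (F y) \<partial>M)"
  shows "(\<Sum>i\<in>I. emeasure M (E i) * ennreal (a i powr (q + 1)))
    \<le> ennreal (4 * 2 powr (1 / q) * 2 powr q) * ennreal c ^ 2 * (\<integral>\<^sup>+y. ennreal (F y powr (q + 1)) \<partial>M)"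
proof -
  interpret sigma_finite_measure M by (rule sigma_finite)
  interpret P: pair_sigma_finite M lborel ..
  define w where "w = 1 / q"
  define D where "D = ennreal (2 * 2 powr w)"
  have level: "ennreal (u powr w) * (\<Sum>i\<in>I. emeasure M (E i) * indicator {0<..<a i powr q} u)
      \<le> 2 * ennreal c ^ 2 * (\<integral>\<^sup>+y. ennreal (F y) * indicator {0<..<(2 * F y) powr q} u \<partial>M)" for u
  proof (cases "u > 0")
    case True
    define t where "t = u powr w"
    have t: "t > 0" and tq: "t powr q = u"
      using True q by (auto simp: t_def w_def powr_powr)
    have iff: "u < b powr q \<longleftrightarrow> t < b" if "b \<ge> 0" for b
    proof
      show "t < b \<Longrightarrow> u < b powr q"
        unfolding tq[symmetric] using t q by (intro powr_less_mono2) auto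
      show "u < b powr q \<Longrightarrow> t < b"
        unfolding tq[symmetric] using t q that powr_mono2[of q b t] by (meson less_imp_le not_less)
    qed
    let ?I = "{i \<in> I. t < a i}"
    have [measurable]: "{y. t < 2 * F y} \<in> sets M"
      using borel_measurable_less[of "\<lambda>_. t" M "\<lambda>y. 2 * F y"] by (simp add: space_eq)
    have "ennreal (t / 2) * (\<Sum>i\<in>?I. emeasure M (E i))
        \<le> ennreal c ^ 2 * (\<integral>\<^sup>+y. ennreal (F y) * indicator {y. t < 2 * F y} y \<partial>M)"
    proof (rule weak_type)
      show "disjoint_family_on E ?I"
        using E(1) by (rule disjoint_family_on_mono[rotated]) auto
      show "ennreal (t / 2) * emeasure M (ball (x i) (r i))
          \<le> (\<integral>\<^sup>+y\<in>ball (x i) (r i). ennreal (F y) * indicator {y. t < 2 * F y} y \<partial>M)"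
        if "i \<in> ?I" for i
        using that I avg t by (intro truncated_average[where a = "a i"]) auto
    qed (use I E in auto)
    then have "2 * (ennreal (t / 2) * (\<Sum>i\<in>?I. emeasure M (E i)))
        \<le> 2 * (ennreal c ^ 2 * (\<integral>\<^sup>+y. ennreal (F y) * indicator {y. t < 2 * F y} y \<partial>M))"
      by (intro mult_left_mono) auto
    also have "2 * (ennreal (t / 2) * (\<Sum>i\<in>?I. emeasure M (E i)))
        = ennreal t * (\<Sum>i\<in>?I. emeasure M (E i))"
    proof -
      have "2 * ennreal (t / 2) = ennreal t"
        using t by (metis ennreal_mult' ennreal_numeral nonzero_mult_div_cancel_left times_divide_eq_right
            zero_le_numeral zero_neq_numeral)
      then show ?thesis by (simp add: mult.assoc[symmetric])
    qed
    also have "(\<Sum>i\<in>?I. emeasure M (E i)) = (\<Sum>i\<in>I. emeasure M (E i) * indicator {0<..<a i powr q} u)"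
      using I True a0 by (intro sum.mono_neutral_cong_left) (auto simp: indicator_def iff)
    also have "(\<integral>\<^sup>+y. ennreal (F y) * indicator {y. t < 2 * F y} y \<partial>M)
        = (\<integral>\<^sup>+y. ennreal (F y) * indicator {0<..<(2 * F y) powr q} u \<partial>M)"
      using True F0 by (intro nn_integral_cong) (auto simp: indicator_def iff)
    finally show ?thesis by (simp add: t_def mult.assoc)
  qed simp
  have "(\<Sum>i\<in>I. emeasure M (E i) * ennreal (a i powr (q + 1)))
      \<le> (\<Sum>i\<in>I. emeasure M (E i) * (D *
            (\<integral>\<^sup>+u. ennreal (u powr w) * indicator {0<..<a i powr q} u \<partial>lborel)))"
    unfolding D_def w_def by (intro sum_mono mult_left_mono powr_le_layers a0 q) auto
  also have "\<dots> = D * (\<integral>\<^sup>+u. ennreal (u powr w) *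
            (\<Sum>i\<in>I. emeasure M (E i) * indicator {0<..<a i powr q} u) \<partial>lborel)"
    by (simp add: sum_distrib_left nn_integral_sum mult_ac flip: nn_integral_cmult)
  also have "\<dots> \<le> D * (\<integral>\<^sup>+u. 2 * ennreal c ^ 2 *
            (\<integral>\<^sup>+y. ennreal (F y) * indicator {0<..<(2 * F y) powr q} u \<partial>M) \<partial>lborel)"
    by (intro mult_left_mono nn_integral_mono level) auto
  also have "\<dots> = D * (2 * ennreal c ^ 2 *
            (\<integral>\<^sup>+u. (\<integral>\<^sup>+y. ennreal (F y) * indicator {0<..<(2 * F y) powr q} u \<partial>M) \<partial>lborel))"
    \<comment> \<open>As an explicit comparison of \<open>u\<close> with \<open>(2 * F y) powr q\<close>, the indicator is visibly jointly
      measurable in \<open>u\<close> and \<open>y\<close>; its interval depends on \<open>y\<close>.\<close>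
    unfolding indicator_def greaterThanLessThan_iff
    by (rule arg_cong[where f = "\<lambda>z. D * z"], rule nn_integral_cmult) measurable
  also have "(\<integral>\<^sup>+u. (\<integral>\<^sup>+y. ennreal (F y) * indicator {0<..<(2 * F y) powr q} u \<partial>M) \<partial>lborel)
      = (\<integral>\<^sup>+y. (\<integral>\<^sup>+u. ennreal (F y) * indicator {0<..<(2 * F y) powr q} u \<partial>lborel) \<partial>M)"
    unfolding indicator_def greaterThanLessThan_iff by (rule P.Fubini') measurable
  also have "\<dots> = (\<integral>\<^sup>+y. ennreal (2 powr q) * ennreal (F y powr (q + 1)) \<partial>M)"
  proof (rule nn_integral_cong)
    fix y
    have "(\<integral>\<^sup>+u. ennreal (F y) * indicator {0<..<(2 * F y) powr q} u \<partial>lborel)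
        = ennreal (F y * (2 * F y) powr q)"
      by (simp add: nn_integral_cmult_indicator ennreal_mult F0)
    also have "F y * (2 * F y) powr q = 2 powr q * F y powr (q + 1)"
      using F0[of y] by (simp add: powr_mult powr_add)
    finally show "(\<integral>\<^sup>+u. ennreal (F y) * indicator {0<..<(2 * F y) powr q} u \<partial>lborel)
        = ennreal (2 powr q) * ennreal (F y powr (q + 1))"
      by (simp add: ennreal_mult)
  qed
  also have "\<dots> = ennreal (2 powr q) * (\<integral>\<^sup>+y. ennreal (F y powr (q + 1)) \<partial>M)"
    by (rule nn_integral_cmult) measurable
  also have "D * (2 * ennreal c ^ 2 * (ennreal (2 powr q) * (\<integral>\<^sup>+y. ennreal (F y powr (q + 1)) \<partial>M)))
     = (D * 2 * ennreal (2 powr q)) * ennreal c ^ 2 * (\<integral>\<^sup>+y. ennreal (F y powr (q + 1)) \<partial>M)"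
    by (simp add: mult_ac)
  also have "D * 2 * ennreal (2 powr q) = ennreal (4 * 2 powr (1 / q) * 2 powr q)"
  proof -
    have "D * 2 * ennreal (2 powr q) = ennreal (2 * 2 powr w * 2 * 2 powr q)"
      unfolding D_def by (simp only: ennreal_mult ennreal_numeral powr_ge_zero mult_nonneg_nonneg zero_le_numeral)
    also have "2 * 2 powr w * 2 * 2 powr q = 4 * 2 powr (1 / q) * 2 powr q"
      by (simp add: w_def)
    finally show ?thesis .
  qed
  finally show ?thesis .
qed

section \<open>John-Nirenberg sums of \<open>L\<^sup>p\<close> functions\<close>

text \<open>
  Triangle inequality under the integral, with \<open>\<bar>f\<^sub>B\<bar>\<close> in turn bounded by the average of \<open>\<bar>f\<bar>\<close>.
\<close>
lemma oscillation_le: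
  fixes f :: "'a \<Rightarrow> real"
  assumes r: "r > 0" and int: "set_integrable M (ball x r) f"
  shows "average M (ball x r) (\<lambda>y. \<bar>f y - average M (ball x r) f\<bar>)
           \<le> 2 * average M (ball x r) (\<lambda>y. \<bar>f y\<bar>)"
proof -
  let ?B = "ball x r"
  let ?m = "measure M ?B"
  define g where "g = average M ?B f"
  have m: "?m > 0" by (rule measure_ball_pos[OF r])
  have const: "set_integrable M ?B (\<lambda>_. b)" for b :: real
    unfolding set_integrable_def using ball_finite[OF r, of x] by simp
  have abs: "set_integrable M ?B (\<lambda>y. \<bar>f y\<bar>)"
    by (rule set_integrable_abs[OF int])
  have "\<bar>set_lebesgue_integral M ?B f\<bar> \<le> set_lebesgue_integral M ?B (\<lambda>y. \<bar>f y\<bar>)"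
    using set_integral_norm_bound[OF int] by simp
  then have g: "\<bar>g\<bar> \<le> average M ?B (\<lambda>y. \<bar>f y\<bar>)"
    using m by (simp add: g_def average_def abs_mult field_simps)
  have "set_lebesgue_integral M ?B (\<lambda>y. \<bar>f y - g\<bar>)
      \<le> set_lebesgue_integral M ?B (\<lambda>y. \<bar>f y\<bar> + \<bar>g\<bar>)"
    by (intro set_integral_mono set_integrable_abs set_integral_diff set_integral_add abs int const)
       auto
  also have "\<dots> = set_lebesgue_integral M ?B (\<lambda>y. \<bar>f y\<bar>) + ?m * \<bar>g\<bar>"
    using ball_finite[OF r, of x]
    by (subst set_integral_add) (auto simp: abs const set_lebesgue_integral_def)
  finally have "average M ?B (\<lambda>y. \<bar>f y - g\<bar>) \<le> average M ?B (\<lambda>y. \<bar>f y\<bar>) + \<bar>g\<bar>"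
    using m by (simp add: average_def field_simps)
  then show ?thesis using g by (simp add: g_def)
qed

text \<open>Balls have finite measure, and \<open>\<bar>f\<bar> \<le> 1 + \<bar>f\<bar>\<^sup>p\<close> pointwise.\<close>
lemma Lp_on_set_integrable:
  assumes f: "f \<in> Lp_on M p A" and p: "1 < p"
    and B: "ball x r \<subseteq> A" "r > 0"
  shows "set_integrable M (ball x r) f"
proof -
  have meas: "set_borel_measurable M A f" and int: "set_integrable M A (\<lambda>y. \<bar>f y\<bar> powr p)"
    using f by (auto simp: Lp_on_def)
  have "set_integrable M (ball x r) (\<lambda>y. 1 + \<bar>f y\<bar> powr p)"
  proof (rule set_integral_add)
    show "set_integrable M (ball x r) (\<lambda>y. \<bar>f y\<bar> powr p)"
      using int ball_sets B(1) by (rule set_integrable_subset)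
    show "set_integrable M (ball x r) (\<lambda>_. 1 :: real)"
      unfolding set_integrable_def using ball_finite[OF B(2), of x] by simp
  qed
  then show ?thesis
  proof (rule set_integrable_bound)
    show "set_borel_measurable M (ball x r) f"
      using meas ball_sets B(1) by (rule set_borel_measurable_subset)
    have "\<bar>v\<bar> \<le> \<bar>1 + \<bar>v\<bar> powr p\<bar>" for v :: real
    proof (cases "\<bar>v\<bar> \<le> 1")
      case False
      then show ?thesis using powr_mono[of 1 p "\<bar>v\<bar>"] p by simp
    qed (use powr_ge_zero[of "\<bar>v\<bar>" p] in linarith)
    then show "AE y in M. y \<in> ball x r \<longrightarrow> norm (f y) \<le> norm (1 + \<bar>f y\<bar> powr p)"
      by simp
  qed
qed

lemma Lp_on_imp_JN:
  assumes p: "1 < p" and f: "f \<in> Lp_on M p (ball x0 (11 * r0))"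
  shows "f \<in> JN M p x0 r0"
proof -
  define A where "A = ball x0 (11 * r0)"
  have [measurable]: "A \<in> sets M" unfolding A_def by (rule ball_sets)
  define q where "q = p - 1"
  have q: "q > 0" and qp: "q + 1 = p" using p by (auto simp: q_def)
  \<comment> \<open>The values of \<open>f\<close> outside \<open>A\<close> are arbitrary, so it is cut off there.\<close>
  define F where "F = (\<lambda>y. \<bar>indicator A y * f y\<bar>)"
  have "set_borel_measurable M A f" and intp: "set_integrable M A (\<lambda>y. \<bar>f y\<bar> powr p)"
    using f by (auto simp: Lp_on_def A_def)
  then have [measurable]: "F \<in> borel_measurable M"
    unfolding F_def set_borel_measurable_def by simp
  have F0: "0 \<le> F y" for y by (simp add: F_def)
  have "integrable M (\<lambda>y. F y powr p)"
  proof -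
    have "(\<lambda>y. F y powr p) = (\<lambda>y. indicator A y *\<^sub>R \<bar>f y\<bar> powr p)"
      by (auto simp: F_def indicator_def fun_eq_iff)
    then show ?thesis using intp by (simp add: set_integrable_def)
  qed
  then obtain N where N: "(\<integral>\<^sup>+y. ennreal (F y powr p) \<partial>M) = ennreal N" "N \<ge> 0"
    using nn_integral_eq_integral[of M "\<lambda>y. F y powr p"]
      Bochner_Integration.integral_nonneg[of M "\<lambda>y. F y powr p"] by simp
  have int: "set_integrable M (ball x r) f" if "r > 0" "ball x r \<subseteq> A" for x r
    using Lp_on_set_integrable[OF f p] that by (auto simp: A_def)
  \<comment> \<open>\<open>C\<close> comes from the strong-type bound; \<open>2 powr p\<close> from the oscillation; the third power of the
    doubling constant compares a ball with its fifth, as \<open>1 \<le> 8/5\<close>. Since \<open>ennreal\<close> truncates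
    negative reals to 0, \<open>ennreal c\<close> is represented by the nonnegative real \<open>max 0 c\<close>.\<close>
  define C where "C = 4 * 2 powr (1 / q) * 2 powr q"
  define K where "K = 2 powr p * (max 0 c ^ 3 * (C * max 0 c ^ 2 * N))"
  have C0: "C \<ge> 0" by (simp add: C_def)
  have K0: "K \<ge> 0" using C0 N(2) by (simp add: K_def)
  have finite_bound: "(\<Sum>(x, r)\<in>S. ennreal (measure M (ball x r) *
      (average M (ball x r) (\<lambda>y. \<bar>f y - average M (ball x r) f\<bar>)) powr p)) \<le> ennreal K"
    if S: "finite S" "\<And>x r. (x, r) \<in> S \<Longrightarrow> r > 0 \<and> ball x r \<subseteq> A"
      "disjoint_family_on (\<lambda>(x, r). ball x (r / 5)) S" for S
  proof -
    define a where "a = (\<lambda>i. average M (ball (fst i) (snd i)) (\<lambda>y. \<bar>f y\<bar>))"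
    have a0: "0 \<le> a i" for i
      by (simp add: a_def average_def set_lebesgue_integral_def)
    have term_bound: "ennreal (measure M (ball (fst i) (snd i)) * (average M (ball (fst i) (snd i))
          (\<lambda>y. \<bar>f y - average M (ball (fst i) (snd i)) f\<bar>)) powr p)
        \<le> ennreal (2 powr p) * (ennreal c ^ 3 *
           (emeasure M (ball (fst i) (snd i / 5)) * ennreal (a i powr p)))" if "i \<in> S" for i
    proof -
      obtain x r where i: "i = (x, r)" by (cases i)
      have r: "r > 0" "ball x r \<subseteq> A" using S(2) that i by auto
      let ?o = "average M (ball x r) (\<lambda>y. \<bar>f y - average M (ball x r) f\<bar>)"
      have "0 \<le> ?o" by (subst average_def) (simp add: set_lebesgue_integral_def)
      then have "?o powr p \<le> (2 * a i) powr p"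
        using oscillation_le[OF r(1) int[OF r]] p by (intro powr_mono2) (auto simp: a_def i)
      also have "\<dots> = 2 powr p * a i powr p" using a0 by (simp add: powr_mult)
      finally have "ennreal (measure M (ball x r) * ?o powr p)
          \<le> ennreal (2 powr p) * (emeasure M (ball x r) * ennreal (a i powr p))"
        using r(1) by (simp add: emeasure_ball_eq mult_left_mono mult.left_commute flip: ennreal_mult)
      also have "\<dots> \<le> ennreal (2 powr p) *
          (ennreal c ^ 3 * emeasure M (ball x (r / 5)) * ennreal (a i powr p))"
        using r(1) by (intro mult_left_mono mult_right_mono ball_double_power) auto
      finally show ?thesis by (simp add: i mult.assoc)
    qed
    have avg: "ennreal (a i) * emeasure M (ball (fst i) (snd i))
        \<le> (\<integral>\<^sup>+y\<in>ball (fst i) (snd i). ennreal (F y) \<partial>M)" if "i \<in> S" for i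
    proof -
      obtain x r where i: "i = (x, r)" by (cases i)
      have r: "r > 0" "ball x r \<subseteq> A" using S(2) that i by auto
      have "integrable M (\<lambda>y. indicator (ball x r) y *\<^sub>R \<bar>f y\<bar>)"
        using set_integrable_abs[OF int[OF r]] by (simp add: set_integrable_def)
      then have "ennreal (set_lebesgue_integral M (ball x r) (\<lambda>y. \<bar>f y\<bar>))
          = (\<integral>\<^sup>+y. ennreal (indicator (ball x r) y *\<^sub>R \<bar>f y\<bar>) \<partial>M)"
        unfolding set_lebesgue_integral_def by (intro nn_integral_eq_integral[symmetric]) auto
      also have "\<dots> = (\<integral>\<^sup>+y\<in>ball x r. ennreal (F y) \<partial>M)"
        using r(2) by (intro nn_integral_cong) (auto simp: F_def indicator_def)
      finally show ?thesis
        using r(1) measure_ball_pos[OF r(1), of x] a0[of i]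
        by (simp add: i a_def average_def emeasure_ball_eq flip: ennreal_mult)
    qed
    have "(\<Sum>(x, r)\<in>S. ennreal (measure M (ball x r) *
        (average M (ball x r) (\<lambda>y. \<bar>f y - average M (ball x r) f\<bar>)) powr p))
        \<le> (\<Sum>i\<in>S. ennreal (2 powr p) * (ennreal c ^ 3 *
            (emeasure M (ball (fst i) (snd i / 5)) * ennreal (a i powr p))))"
      using term_bound by (intro sum_mono) (auto simp: case_prod_beta)
    also have "\<dots> = ennreal (2 powr p) * (ennreal c ^ 3 *
        (\<Sum>i\<in>S. emeasure M (ball (fst i) (snd i / 5)) * ennreal (a i powr p)))"
      by (simp add: sum_distrib_left)
    also have "(\<Sum>i\<in>S. emeasure M (ball (fst i) (snd i / 5)) * ennreal (a i powr p))
        \<le> ennreal C * ennreal c ^ 2 * (\<integral>\<^sup>+y. ennreal (F y powr p) \<partial>M)"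
      unfolding qp[symmetric] C_def
    proof (rule strong_type[where x = fst and r = snd])
      show "disjoint_family_on (\<lambda>i. ball (fst i) (snd i / 5)) S"
        using S(3) by (simp add: case_prod_beta')
      show "ball (fst i) (snd i / 5) \<subseteq> ball (fst i) (snd i)" if "i \<in> S" for i
        using S(2)[of "fst i" "snd i"] that by (intro subset_ball) auto
      show "snd i > 0" if "i \<in> S" for i
        using S(2)[of "fst i" "snd i"] that by auto
    qed (use S(1) q F0 a0 avg in auto)
    also have "ennreal (2 powr p) * (ennreal c ^ 3 * (ennreal C * ennreal c ^ 2 *
        (\<integral>\<^sup>+y. ennreal (F y powr p) \<partial>M))) = ennreal K"
    proof -
      have c: "ennreal c ^ n = ennreal (max 0 c ^ n)" for n
        by (simp add: ennreal_power[symmetric] ennreal_max_0)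
      show ?thesis
        unfolding N(1) K_def c using C0 N(2) by (simp add: ennreal_mult)
    qed
    finally show ?thesis by (simp add: mult_left_mono)
  qed
  show ?thesis
    unfolding JN_def
  proof (intro CollectI conjI allI impI exI[of _ "K powr (1 / p)"])
    fix x r assume "r > 0 \<and> ball x r \<subseteq> ball x0 (11 * r0)"
    then show "set_integrable M (ball x r) f" using int by (auto simp: A_def)
  next
    fix \<B> :: "('a \<times> real) set"
    assume B: "countable \<B> \<and>
            (\<forall>(x, r)\<in>\<B>. r > 0 \<and> x \<in> ball x0 r0 \<and> ball x r \<subseteq> ball x0 (11 * r0)) \<and>
            disjoint_family_on (\<lambda>(x, r). ball x (r / 5)) \<B>"
    have "(K powr (1 / p)) powr p = K" using K0 p by (simp add: powr_powr)
    moreover have "(\<Sum>\<^sub>\<infinity>(x, r)\<in>\<B>. ennreal (measure M (ball x r) *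
        (average M (ball x r) (\<lambda>y. \<bar>f y - average M (ball x r) f\<bar>)) powr p)) \<le> ennreal K"
    proof (rule infsum_le_finite_sums)
      fix S assume S: "finite S" "S \<subseteq> \<B>"
      show "(\<Sum>(x, r)\<in>S. ennreal (measure M (ball x r) *
          (average M (ball x r) (\<lambda>y. \<bar>f y - average M (ball x r) f\<bar>)) powr p)) \<le> ennreal K"
      proof (rule finite_bound[OF S(1)])
        show "disjoint_family_on (\<lambda>(x, r). ball x (r / 5)) S"
          using B S(2) by (blast intro: disjoint_family_on_mono)
      qed (use B S(2) in \<open>unfold A_def, blast\<close>)
    qed (rule nonneg_summable_on_complete, auto)
    ultimately show "(\<Sum>\<^sub>\<infinity>(x, r)\<in>\<B>. ennreal (measure M (ball x r) *
        (average M (ball x r) (\<lambda>y. \<bar>f y - average M (ball x r) f\<bar>)) powr p))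
        \<le> ennreal ((K powr (1 / p)) powr p)"
      by simp
  qed simp
qed

end

theorem proposition3p4:
  fixes M :: "'a::metric_space measure"
    and x0 :: 'a and r0 p :: real and f :: "'a \<Rightarrow> real"
  assumes "borel_regular M"
    and "doubling M"
    and "r0 > 0"
    and "1 < p"
    and "f \<in> Lp_on M p (ball x0 (11 * r0))"
  shows "f \<in> JN M p x0 r0"
proof -
  obtain c where c: "1 \<le> c"
    "\<forall>x r. r > 0 \<longrightarrow> emeasure M (ball x (2 * r)) \<le> ennreal c * emeasure M (ball x r)"
    using assms(2) unfolding doubling_def by (elim conjE exE)
  have "doubling_measure M c"
  proof
    show "sets borel \<subseteq> sets M"
      using assms(1) unfolding borel_regular_def by (rule conjunct1)
  qed (use assms(2) c(2) in \<open>simp_all add: doubling_def\<close>)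
  then show ?thesis
    using assms(4,5) by (intro doubling_measure.Lp_on_imp_JN)
qed

end
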